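(* Let $1<\gamma<2$, let $F$ be the cumulative distribution function of a random variable taking positive integer values with probability $1$ such that $1-F(x)=L(x)x^{-\gamma}$ for all $x>0$, where $L$ is slowly varying at infinity. Let $D_1,\dots,D_n$ be the parity-corrected random degrees obtained from $n$ i.i.d. random variables with distribution $F$ (as defined in the context). Then for any $\varepsilon>0$ and any $\alpha$ such that $1<\alpha<\min\left\{2-\frac{\gamma}{2},\gamma\right\}$, with probability $1-O(n^{1-\alpha})$ as $n\to\infty$ the following holds: every simple graph $G_n$ on the vertex set $\{1,\dots,n\}$ in which vertex $i$ has degree $D_i$ for every $i$ satisfies $$C_1(G_n)\le n^{\varepsilon-\frac{(\gamma-2)^2}{2\gamma}},$$ where $C_1(G_n)$ is the global clustering coefficient of $G_n$.
   Context: A function $L:(0,\infty)\to(0,\infty)$ is slowly varying (at infinity) if $\lim_{x\to\infty} L(tx)/L(x)=1$ for every fixed $t>0$. Random degrees: for each $n$, let $\xi_1,\dots,\xi_n$ be independent random variables with cumulative distribution function $F$. Put $D_i=\xi_i$ for $i<n$, and $D_n=\xi_n$ if $\sum_{i=1}^n\xi_i$ is even, $D_n=\xi_n+1$ if $\sum_{i=1}^n\xi_i$ is odd. A simple graph is an undirected graph without loops and multiple edges. The global clustering coefficient $C_1(G)$ of a simple graph $G$ is the ratio of three times the number of triangles in $G$ to the number of pairs of adjacent edges in $G$, i.e. to the number of unordered pairs of distinct edges sharing a vertex, which equals $\sum_v \binom{\deg v}{2}$ (set $C_1(G)=0$ if there are no such pairs). The distribution $F$ and the parameters $\varepsilon,\alpha$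 are fixed as $n\to\infty$; the constant implied by $O(\cdot)$ may depend on them but not on $n$. *)

theory Defs
  imports "HOL-Probability.Probability" "HOL-Library.Landau_Symbols"
begin

text \<open>Only the values of the function on the positive half-line are constrained.\<close>

definition slowly_varying :: "(real \<Rightarrow> real) \<Rightarrow> bool" where
  "slowly_varying L \<longleftrightarrow>
     (\<forall>x>0. L x > 0) \<and> (\<forall>t>0. ((\<lambda>x. L (t * x) / L x) \<longlongrightarrow> 1) at_top)"

text \<open>The degrees are real numbers, since the underlying random variables are real-valued and
  integral only almost surely. If the sum is not an integer, no correction is made.\<close>

definition parity_corrected_degree :: "nat \<Rightarrow> (nat \<Rightarrow> real) \<Rightarrow> nat \<Rightarrow> real" where
  "parity_corrected_degree n x i =
     (if i = n \<and> (\<exists>k::int. odd k \<and> (\<Sum>j=1..n. x j) = of_int k) then x i + 1 else x i)"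

text \<open>A simple graph is given by its vertex set and its set of edges, an edge being the set of its
  two end points.\<close>

definition simple_graph :: "'a set \<Rightarrow> 'a set set \<Rightarrow> bool" where
  "simple_graph V E \<longleftrightarrow> finite V \<and> (\<forall>e\<in>E. e \<subseteq> V \<and> card e = 2)"

definition vertex_degree :: "'a set set \<Rightarrow> 'a \<Rightarrow> nat" where
  "vertex_degree E v = card {e \<in> E. v \<in> e}"

definition triangles :: "'a set set \<Rightarrow> 'a set set" where
  "triangles E = {T. card T = 3 \<and> (\<forall>u\<in>T. \<forall>v\<in>T. u \<noteq> v \<longrightarrow> {u, v} \<in> E)}"

definition adjacent_edge_pairs :: "'a set set \<Rightarrow> 'a set set set" where
  "adjacent_edge_pairs E = {{e, f} |e f. e \<in> E \<and> f \<in> E \<and> e \<noteq> f \<and> e \<inter> f \<noteq> {}}"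

text \<open>Because of \<open>x / 0 = 0\<close> the coefficient is 0 if there are no adjacent edges.\<close>

definition global_clustering :: "'a set set \<Rightarrow> real" where
  "global_clustering E =
     3 * real (card (triangles E)) / real (card (adjacent_edge_pairs E))"

end

theory Submission
  imports Defs "HOL-Real_Asymp.Real_Asymp"
begin

text \<open>
Vertices are split at degree \<open>\<surd>n\<close>. A triangle either has all its corners among the \<open>N\<close> vertices above
that threshold, or it has a corner \<open>v\<close> below it and is spanned by two of the edges at \<open>v\<close>. So there are
at most \<open>N^3\<close> triangles of the first kind, and at most the sum of the squared degrees below the
threshold of the second. Both quantities are controlled by the single random variable
\<open>W = (\<Sum>i. min (D_i^2 / n) 1)\<close>: the number of triangles is at most \<open>W^3 + n * W\<close>
(\<open>card_triangles_le_truncated_sum\<close>). On the other hand, one vertex of degree \<open>m\<close> lies on about \<open>m^2 / 2\<close>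
pairs of adjacent edges. These facts hold for every graph with the given degrees, so that all
that remains is to estimate \<open>W\<close> from above and the largest degree from below.

Up to factors \<open>n powr \<delta>\<close> the mean of \<open>W\<close> is at most \<open>n powr (1 - \<gamma> / 2)\<close>, since the degrees have finite moments
of every order \<open>s < \<gamma>\<close>. This exponent is less than \<open>1 / 2\<close> as \<open>\<gamma> > 1\<close>; hence \<open>n * W\<close> dominates \<open>W^3\<close> and there are
at most \<open>n powr (2 - \<gamma> / 2)\<close> triangles. The largest degree is at least \<open>n powr (1 / \<gamma>)\<close>, again up to such a
factor. The ratio has the exponent \<open>2 - \<gamma> / 2 - 2 / \<gamma> = - (\<gamma> - 2)^2 / (2 * \<gamma>)\<close>.

Since \<open>W\<close> is essentially a sum of independent variables with values in \<open>[0, 1]\<close>, a Chernoff bound shows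
that it exceeds a multiple of the bound for its mean only with probability \<open>exp (- (n powr a))\<close> for some \<open>a > 0\<close>
(\<open>truncated_sum_upper_tail\<close>), and by independence the largest degree is too small with a probability
of the same kind (\<open>all_samples_le_probability\<close>). Both are smaller than any power of \<open>n\<close>, and
in particular than \<open>n powr (1 - \<alpha>)\<close>.
\<close>

section \<open>Triangles and adjacent edges in terms of degrees\<close>

text \<open>Two edges at a vertex determine at most one triangle.\<close>

lemma triangles_through_vertex:
  assumes "simple_graph V E"
  shows "finite {T \<in> triangles E. v \<in> T}"
    and "card {T \<in> triangles E. v \<in> T} \<le> (vertex_degree E v)\<^sup>2"
proof -
  let ?I = "{e \<in> E. v \<in> e}"
  have "?I \<subseteq> Pow V" "finite V"
    using assms by (auto simp: simple_graph_def)
  then have fin: "finite ?I"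
    by (simp add: finite_subset)
  have sub: "{T \<in> triangles E. v \<in> T} \<subseteq> (\<lambda>(e, f). e \<union> f) ` (?I \<times> ?I)"
  proof
    fix T assume "T \<in> {T \<in> triangles E. v \<in> T}"
    then have T: "card T = 3" "v \<in> T" "\<And>a b. a \<in> T \<Longrightarrow> b \<in> T \<Longrightarrow> a \<noteq> b \<Longrightarrow> {a, b} \<in> E"
      by (auto simp: triangles_def)
    from T(1,2) have "card (T - {v}) = 2"
      by simp
    then obtain a b where ab: "T - {v} = {a, b}" "a \<noteq> b"
      by (meson card_2_iff)
    then have "T = {v, a} \<union> {v, b}"
      using T(2) by auto
    moreover have "{v, a} \<in> ?I" "{v, b} \<in> ?I"
      using T ab by auto
    ultimately show "T \<in> (\<lambda>(e, f). e \<union> f) ` (?I \<times> ?I)"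
      by (intro image_eqI[of _ _ "({v, a}, {v, b})"]) auto
  qed
  have "card ((\<lambda>(e, f). e \<union> f) ` (?I \<times> ?I)) \<le> card (?I \<times> ?I)"
    using fin by (intro card_image_le) auto
  with card_mono[OF _ sub] fin show "card {T \<in> triangles E. v \<in> T} \<le> (vertex_degree E v)\<^sup>2"
    by (auto simp: vertex_degree_def card_cartesian_product power2_eq_square)
  show "finite {T \<in> triangles E. v \<in> T}"
    using finite_subset[OF sub] fin by blast
qed

text \<open>The set \<open>S\<close> is to be thought of as the few vertices of large degree, on which counting all triples is
cheap. Any other triangle has a corner outside \<open>S\<close> and is charged to that corner.\<close>

lemma card_triangles_le:
  assumes G: "simple_graph V E" and S: "S \<subseteq> V"
  shows "card (triangles E) \<le> card S ^ 3 + (\<Sum>v\<in>V - S. (vertex_degree E v)\<^sup>2)"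
proof -
  have finV: "finite V" and finS: "finite S"
    using G S by (auto simp: simple_graph_def intro: finite_subset)
  have tri_V: "T \<subseteq> V" if "T \<in> triangles E" for T
  proof
    fix u assume "u \<in> T"
    have "card T = 3" using that by (simp add: triangles_def)
    then have "\<not> T \<subseteq> {u}"
      by (metis card.empty card_1_singleton_iff subset_singletonD numeral_eq_one_iff
            num.distinct(3) zero_neq_numeral One_nat_def)
    then obtain w where "w \<in> T" "u \<noteq> w" by auto
    with \<open>u \<in> T\<close> that have "{u, w} \<in> E" by (auto simp: triangles_def)
    then show "u \<in> V" using G by (auto simp: simple_graph_def)
  qed
  let ?high = "{T. T \<subseteq> S \<and> card T = 3}"
  let ?low = "\<Union>v\<in>V - S. {T \<in> triangles E. v \<in> T}"
  have sub: "triangles E \<subseteq> ?high \<union> ?low"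
  proof
    fix T assume T: "T \<in> triangles E"
    show "T \<in> ?high \<union> ?low"
    proof (cases "T \<subseteq> S")
      case True then show ?thesis using T by (auto simp: triangles_def)
    next
      case False then show ?thesis using T tri_V[OF T] by auto
    qed
  qed
  note through = triangles_through_vertex[OF G]
  have "card (triangles E) \<le> card (?high \<union> ?low)"
    using finS finV through by (intro card_mono[OF _ sub]) auto
  also have "\<dots> \<le> card ?high + card ?low"
    by (rule card_Un_le)
  also have "card ?high \<le> card S ^ 3"
    unfolding n_subsets[OF finS]
    by (metis binomial_eq_0 binomial_le_pow linorder_not_less zero_le)
  also have "card ?low \<le> (\<Sum>v\<in>V - S. card {T \<in> triangles E. v \<in> T})"
    using finV by (intro card_UN_le) auto
  also have "\<dots> \<le> (\<Sum>v\<in>V - S. (vertex_degree E v)\<^sup>2)"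
    by (intro sum_mono through)
  finally show ?thesis by simp
qed

text \<open>A single vertex already gives many pairs of adjacent edges; for heavy-tailed degrees the largest
one gives the right order of magnitude.\<close>

lemma choose_two_le_card_adjacent_edge_pairs:
  assumes "simple_graph V E"
  shows "vertex_degree E v choose 2 \<le> card (adjacent_edge_pairs E)"
proof -
  have "E \<subseteq> Pow V" "finite V"
    using assms by (auto simp: simple_graph_def)
  then have finE: "finite E"
    using finite_subset by blast
  have "{B. B \<subseteq> {e \<in> E. v \<in> e} \<and> card B = 2} \<subseteq> adjacent_edge_pairs E"
  proof
    fix B assume "B \<in> {B. B \<subseteq> {e \<in> E. v \<in> e} \<and> card B = 2}"
    then obtain e f where "B = {e, f}" "e \<noteq> f" "e \<in> E" "f \<in> E" "v \<in> e" "v \<in> f"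
      by (auto simp: card_2_iff)
    then show "B \<in> adjacent_edge_pairs E"
      unfolding adjacent_edge_pairs_def by blast
  qed
  moreover have "adjacent_edge_pairs E \<subseteq> Pow E"
    by (auto simp: adjacent_edge_pairs_def)
  ultimately have "card {B. B \<subseteq> {e \<in> E. v \<in> e} \<and> card B = 2} \<le> card (adjacent_edge_pairs E)"
    using finE by (intro card_mono) (auto intro: finite_subset)
  then show ?thesis
    using finE by (simp add: n_subsets vertex_degree_def)
qed

text \<open>With the threshold \<open>\<surd>\<tau>\<close> between large and small degrees, the truncated sum \<open>W\<close> controls both
parts of the preceding bound: each vertex of large degree contributes \<open>1\<close> to \<open>W\<close>, and each of the
others contributes its squared degree divided by \<open>\<tau>\<close>.\<close>

lemma card_triangles_le_truncated_sum:
  fixes \<tau> :: real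
  assumes G: "simple_graph V E" and \<tau>: "\<tau> > 0"
  defines "W \<equiv> \<Sum>v\<in>V. min ((real (vertex_degree E v))\<^sup>2 / \<tau>) 1"
  shows "real (card (triangles E)) \<le> W ^ 3 + \<tau> * W"
proof -
  let ?d = "\<lambda>v. real (vertex_degree E v)"
  let ?y = "\<lambda>v. min ((?d v)\<^sup>2 / \<tau>) 1"
  define S where "S = {v \<in> V. (?d v)\<^sup>2 > \<tau>}"
  have finV: "finite V" using G by (simp add: simple_graph_def)
  have y0: "?y v \<ge> 0" for v using \<tau> by simp
  have "real (card S) = (\<Sum>v\<in>S. ?y v)"
    using \<tau> by (simp add: S_def min_def)
  also have "\<dots> \<le> W"
    unfolding W_def using finV y0 by (intro sum_mono2) (auto simp: S_def)
  finally have high: "real (card S) \<le> W" .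
  have "(\<Sum>v\<in>V - S. (?d v)\<^sup>2) = (\<Sum>v\<in>V - S. \<tau> * ?y v)"
    using \<tau> by (intro sum.cong) (auto simp: S_def min_def field_simps)
  also have "\<dots> \<le> (\<Sum>v\<in>V. \<tau> * ?y v)"
    using finV y0 \<tau> by (intro sum_mono2) (auto intro!: mult_nonneg_nonneg)
  also have "\<dots> = \<tau> * W"
    by (simp add: W_def sum_distrib_left)
  finally have low: "(\<Sum>v\<in>V - S. (?d v)\<^sup>2) \<le> \<tau> * W" .
  have "card (triangles E) \<le> card S ^ 3 + (\<Sum>v\<in>V - S. (vertex_degree E v)\<^sup>2)"
    by (intro card_triangles_le G) (auto simp: S_def)
  then have "real (card (triangles E)) \<le> real (card S ^ 3 + (\<Sum>v\<in>V - S. (vertex_degree E v)\<^sup>2))"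
    by (rule of_nat_mono)
  also have "\<dots> = real (card S) ^ 3 + (\<Sum>v\<in>V - S. (?d v)\<^sup>2)"
    by simp
  also have "\<dots> \<le> W ^ 3 + \<tau> * W"
    using high low by (intro add_mono power_mono) auto
  finally show ?thesis .
qed

text \<open>The constant is \<open>12 = 3 * 4\<close>: a vertex of degree \<open>d \<ge> 2\<close> lies on \<open>d * (d - 1) / 2 \<ge> d^2 / 4\<close> pairs of adjacent
edges.\<close>

lemma global_clustering_le:
  fixes \<tau> m w :: real
  assumes G: "simple_graph V E" and \<tau>: "\<tau> > 0" and m: "m \<ge> 2"
    and v: "m \<le> real (vertex_degree E v)"
    and w: "(\<Sum>v\<in>V. min ((real (vertex_degree E v))\<^sup>2 / \<tau>) 1) \<le> w"
  shows "global_clustering E \<le> 12 * (w ^ 3 + \<tau> * w) / m\<^sup>2"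
proof -
  define d where "d = vertex_degree E v"
  let ?W = "\<Sum>v\<in>V. min ((real (vertex_degree E v))\<^sup>2 / \<tau>) 1"
  have d2: "real d \<ge> 2" using m v by (simp add: d_def)
  have "m\<^sup>2 \<le> (real d)\<^sup>2"
    using m v by (intro power_mono) (auto simp: d_def)
  also have "\<dots> \<le> 2 * (real d * (real d - 1))"
    using d2 by (simp add: power2_eq_square algebra_simps)
  also have "real d * (real d - 1) = 2 * real (d choose 2)"
  proof -
    have "d * (d - 1) = 2 * (d choose 2)"
      by (cases d) (simp_all add: choose_two)
    then have "real d * real (d - 1) = 2 * real (d choose 2)"
      by (metis of_nat_mult of_nat_numeral)
    then show ?thesis
      using d2 by simp
  qed
  also have "real (d choose 2) \<le> real (card (adjacent_edge_pairs E))"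
    unfolding d_def by (intro of_nat_mono choose_two_le_card_adjacent_edge_pairs[OF G])
  finally have P: "m\<^sup>2 / 4 \<le> real (card (adjacent_edge_pairs E))"
    by simp
  have W0: "0 \<le> ?W"
    using \<tau> by (intro sum_nonneg) auto
  have "real (card (triangles E)) \<le> ?W ^ 3 + \<tau> * ?W"
    by (rule card_triangles_le_truncated_sum[OF G \<tau>])
  also have "\<dots> \<le> w ^ 3 + \<tau> * w"
    using w W0 \<tau> by (intro add_mono power_mono mult_left_mono) auto
  finally have T: "real (card (triangles E)) \<le> w ^ 3 + \<tau> * w" .
  have "global_clustering E \<le> 3 * (w ^ 3 + \<tau> * w) / (m\<^sup>2 / 4)"
    unfolding global_clustering_def using T P m by (intro frac_le) auto
  then show ?thesis by simp
qed

section \<open>Power bounds for slowly varying functions\<close>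

text \<open>Halving the argument repeatedly brings it into \<open>[x0, 2 x0]\<close> without decreasing the value of \<open>h\<close>.\<close>

lemma bounded_if_dyadically_decreasing:
  fixes h :: "real \<Rightarrow> real"
  assumes x0: "x0 > 0" and dec: "\<And>x. x \<ge> x0 \<Longrightarrow> h (2 * x) \<le> h x"
    and B: "\<And>x. x0 \<le> x \<Longrightarrow> x \<le> 2 * x0 \<Longrightarrow> h x \<le> B" and x: "x \<ge> x0"
  shows "h x \<le> B"
proof -
  obtain k where "x / x0 < 2 ^ k"
    using real_arch_pow[of 2 "x / x0"] by auto
  then have "x \<le> 2 ^ k * x0"
    using x0 by (simp add: field_simps)
  then show ?thesis using x
  proof (induction k arbitrary: x)
    case 0
    then show ?case using B[of x] x0 by simp
  next
    case (Suc k)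
    show ?case
    proof (cases "x \<le> 2 * x0")
      case False
      then have "h (x / 2) \<le> B" by (intro Suc.IH) (use Suc.prems in auto)
      moreover have "h (2 * (x / 2)) \<le> h (x / 2)" by (rule dec) (use False in auto)
      ultimately show ?thesis by simp
    qed (use B Suc.prems in auto)
  qed
qed

text \<open>A weak form of Potter's bounds. Since \<open>L (2 * x) / L x\<close> tends to \<open>1\<close>, the functions \<open>L x * x powr (-\<eta>)\<close> and
\<open>x powr (-\<eta>) / L x\<close> decrease when a large \<open>x\<close> is doubled, so it suffices to bound them on one dyadic
interval. There the monotonicity of \<open>L x * x powr (-\<gamma>)\<close> takes the place of the uniform convergence
theorem.\<close>

lemma slowly_varying_power_bounds:
  fixes L :: "real \<Rightarrow> real"
  assumes L: "slowly_varying L" and \<gamma>: "\<gamma> \<ge> 0" and \<eta>: "\<eta> > 0"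
    and anti: "\<And>x y. 0 < x \<Longrightarrow> x \<le> y \<Longrightarrow> L y * y powr (-\<gamma>) \<le> L x * x powr (-\<gamma>)"
  obtains C where "C > 0"
    and "\<forall>\<^sub>F x in at_top. L x \<le> C * x powr \<eta>" and "\<forall>\<^sub>F x in at_top. x powr (-\<eta>) / C \<le> L x"
proof -
  have pos: "L x > 0" if "x > 0" for x using L that by (auto simp: slowly_varying_def)
  have lim: "((\<lambda>x. L (2 * x) / L x) \<longlongrightarrow> 1) at_top"
    using L by (auto simp: slowly_varying_def)
  have "(1::real) < 2 powr \<eta>" "2 powr (-\<eta>) < (1::real)"
    using \<eta> by (auto simp: powr_less_one)
  from order_tendstoD(2)[OF lim this(1)] order_tendstoD(1)[OF lim this(2)]
  have "\<forall>\<^sub>F x in at_top. L (2 * x) / L x < 2 powr \<eta> \<and> 2 powr (-\<eta>) < L (2 * x) / L x"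
    by eventually_elim auto
  then obtain x1 where x1: "\<And>x. x \<ge> x1 \<Longrightarrow> L (2 * x) / L x < 2 powr \<eta> \<and> 2 powr (-\<eta>) < L (2 * x) / L x"
    by (auto simp: eventually_at_top_linorder)
  define x0 where "x0 = max 1 x1"
  have x0: "x0 > 0" "x0 \<ge> x1" by (auto simp: x0_def)
  define T where "T x = L x * x powr (-\<gamma>)" for x
  have T: "T x > 0" if "x > 0" for x using pos that by (simp add: T_def)
  have LT: "L x = T x * x powr \<gamma>" if "x > 0" for x
    using that by (simp add: T_def powr_minus field_simps)
  have antiT: "T y \<le> T x" if "0 < x" "x \<le> y" for x y
    using anti that by (simp add: T_def)
  define C1 where "C1 = T x0 * (2 * x0) powr \<gamma> * x0 powr (-\<eta>)"
  define C2 where "C2 = x0 powr (-\<eta>) * (1 / (T (2 * x0) * x0 powr \<gamma>))"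
  have upper: "L x * x powr (-\<eta>) \<le> C1" if "x \<ge> x0" for x
  proof (rule bounded_if_dyadically_decreasing[where h = "\<lambda>x. L x * x powr (-\<eta>)", OF x0(1) _ _ that])
    fix x assume x: "x \<ge> x0"
    have "L (2 * x) \<le> 2 powr \<eta> * L x"
      using x1[of x] x x0 pos[of x] by (auto simp: field_simps)
    then have "L (2 * x) * (2 * x) powr (-\<eta>) \<le> 2 powr \<eta> * L x * (2 * x) powr (-\<eta>)"
      by (rule mult_right_mono) auto
    also have "\<dots> = L x * x powr (-\<eta>)"
      using x x0 by (simp add: powr_mult powr_minus field_simps)
    finally show "L (2 * x) * (2 * x) powr (-\<eta>) \<le> L x * x powr (-\<eta>)" .
  next
    fix x assume x: "x0 \<le> x" "x \<le> 2 * x0"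
    have "L x \<le> T x0 * (2 * x0) powr \<gamma>"
      using x x0 \<gamma> T[of x0] T[of x] antiT[of x0 x] by (auto simp: LT intro!: mult_mono powr_mono2)
    moreover have "x powr (-\<eta>) \<le> x0 powr (-\<eta>)"
      using x x0 \<eta> by (intro powr_mono2') auto
    ultimately show "L x * x powr (-\<eta>) \<le> C1"
      unfolding C1_def using pos[of x] x x0 T[of x0] by (intro mult_mono) auto
  qed
  have lower: "x powr (-\<eta>) / L x \<le> C2" if "x \<ge> x0" for x
  proof (rule bounded_if_dyadically_decreasing[where h = "\<lambda>x. x powr (-\<eta>) / L x", OF x0(1) _ _ that])
    fix x assume x: "x \<ge> x0"
    have "2 powr (-\<eta>) * L x \<le> L (2 * x)"
      using x1[of x] x x0 pos[of x] by (auto simp: field_simps)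
    then have "(2 * x) powr (-\<eta>) / L (2 * x) \<le> (2 * x) powr (-\<eta>) / (2 powr (-\<eta>) * L x)"
      using pos[of x] x x0 by (intro divide_left_mono) (auto intro!: mult_pos_pos pos)
    also have "\<dots> = x powr (-\<eta>) / L x"
      using x x0 by (simp add: powr_mult)
    finally show "(2 * x) powr (-\<eta>) / L (2 * x) \<le> x powr (-\<eta>) / L x" .
  next
    fix x assume x: "x0 \<le> x" "x \<le> 2 * x0"
    have "T (2 * x0) * x0 powr \<gamma> \<le> L x"
      using x x0 \<gamma> T[of "2 * x0"] T[of x] antiT[of x "2 * x0"]
      by (auto simp: LT intro!: mult_mono powr_mono2)
    then have "1 / L x \<le> 1 / (T (2 * x0) * x0 powr \<gamma>)"
      using T[of "2 * x0"] x x0 by (intro divide_left_mono mult_pos_pos pos) auto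
    moreover have "x powr (-\<eta>) \<le> x0 powr (-\<eta>)"
      using x x0 \<eta> by (intro powr_mono2') auto
    ultimately have "x powr (-\<eta>) * (1 / L x) \<le> C2"
      unfolding C2_def using pos[of x] x x0 by (intro mult_mono) auto
    then show "x powr (-\<eta>) / L x \<le> C2" by simp
  qed
  define C where "C = max 1 (max C1 C2)"
  show thesis
  proof
    show "C > 0" by (simp add: C_def)
    show "\<forall>\<^sub>F x in at_top. L x \<le> C * x powr \<eta>"
      using eventually_ge_at_top[of x0]
    proof eventually_elim
      case (elim x)
      then have "L x * x powr (-\<eta>) \<le> C" using upper[of x] by (simp add: C_def)
      then show ?case using elim x0 by (simp add: powr_minus field_simps)
    qed
    show "\<forall>\<^sub>F x in at_top. x powr (-\<eta>) / C \<le> L x"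
      using eventually_ge_at_top[of x0]
    proof eventually_elim
      case (elim x)
      then have "x powr (-\<eta>) / L x \<le> C" using lower[of x] by (simp add: C_def)
      then show ?case using elim x0 pos[of x] \<open>C > 0\<close> by (simp add: field_simps)
    qed
  qed
qed

section \<open>Moments and concentration\<close>

text \<open>The moment is compared with the sum over \<open>k\<close> of the tail at \<open>2^k\<close> times \<open>2^((k+1)s)\<close>, which is dominated
by a geometric series of ratio \<open>2 powr (s - \<beta>)\<close>.\<close>

lemma moment_finite_if_tail_le_powr:
  fixes \<nu> :: "real measure" and s \<beta> C :: real
  assumes \<nu>: "real_distribution \<nu>" and nonneg: "AE x in \<nu>. x \<ge> 0"
    and s: "0 < s" "s < \<beta>"
    and tail: "\<forall>\<^sub>F x in at_top. measure \<nu> {x<..} \<le> C * x powr (-\<beta>)"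
  shows "integrable \<nu> (\<lambda>x. \<bar>x\<bar> powr s)"
proof -
  interpret real_distribution \<nu> by fact
  define a :: "nat \<Rightarrow> real" where "a k = (2 ^ Suc k) powr s" for k
  have dyadic: "ennreal (x powr s) \<le> 1 + (\<Sum>k. ennreal (a k) * indicator {2 ^ k<..} x)" if "x \<ge> 0" for x
  proof (cases "x \<le> 1")
    case True
    then have "x powr s \<le> 1"
      using that s by (intro powr_le1) auto
    then show ?thesis
      by (metis add.right_neutral add_mono ennreal_1 ennreal_leI zero_le)
  next
    case False
    define n where "n = (LEAST n. x \<le> 2 ^ n)"
    have ex: "\<exists>n. x \<le> 2 ^ n"
      using real_arch_pow[of 2 x] less_imp_le by auto
    have n: "x \<le> 2 ^ n"
      unfolding n_def by (rule LeastI_ex[OF ex])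
    with False obtain k where k: "n = Suc k"
      by (cases n) auto
    have "\<not> x \<le> 2 ^ k"
      using not_less_Least[of k "\<lambda>n. x \<le> 2 ^ n"] k by (simp add: n_def)
    have "ennreal (x powr s) \<le> ennreal (a k)"
      unfolding a_def using n k that s by (intro ennreal_leI powr_mono2) auto
    also have "\<dots> = (\<Sum>j\<in>{k}. ennreal (a j) * indicator {2 ^ j<..} x)"
      using \<open>\<not> x \<le> 2 ^ k\<close> by simp
    also have "\<dots> \<le> (\<Sum>k. ennreal (a k) * indicator {2 ^ k<..} x)"
      by (rule sum_le_suminf) auto
    finally show ?thesis
      by (simp add: add_increasing)
  qed
  have "summable (\<lambda>k. a k * measure \<nu> {2 ^ k<..})"
  proof (rule summable_comparison_test_ev)
    define q :: real where "q = 2 powr (s - \<beta>)"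
    have "filterlim (\<lambda>k. (2::real) ^ k) at_top sequentially"
      by (intro filterlim_at_infinity_imp_filterlim_at_top filterlim_realpow_sequentially_gt1) auto
    from eventually_compose_filterlim[OF tail this]
    show "\<forall>\<^sub>F k in sequentially. norm (a k * measure \<nu> {2 ^ k<..}) \<le> 2 powr s * C * q ^ k"
    proof eventually_elim
      case (elim k)
      have "a k * measure \<nu> {2 ^ k<..} \<le> a k * (C * (2 ^ k) powr (-\<beta>))"
        by (rule mult_left_mono[OF elim]) (simp add: a_def)
      also have "\<dots> = 2 powr s * C * q ^ k"
      proof -
        have "(2 ^ Suc k) powr s = 2 powr (s + real k * s)"
          by (simp add: powr_realpow[symmetric] powr_powr algebra_simps del: power_Suc)
        moreover have "(2 ^ k) powr (-\<beta>) = 2 powr (-(real k * \<beta>))"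
          by (simp add: powr_realpow[symmetric] powr_powr algebra_simps)
        moreover have "q ^ k = 2 powr (real k * (s - \<beta>))"
          by (simp add: q_def powr_realpow[symmetric] powr_powr mult.commute)
        ultimately show ?thesis
          unfolding a_def by (simp add: powr_add[symmetric] algebra_simps)
      qed
      finally show ?case by (simp add: a_def)
    qed
    have "\<bar>q\<bar> < 1" using s by (simp add: q_def powr_less_one)
    then show "summable (\<lambda>k. 2 powr s * C * q ^ k)"
      by (intro summable_mult summable_geometric) auto
  qed
  then have fin: "(\<Sum>k. ennreal (a k * measure \<nu> {2 ^ k<..})) \<noteq> \<infinity>"
    by (subst suminf_ennreal2) (auto simp: a_def)
  have "(\<integral>\<^sup>+x. ennreal (\<bar>x\<bar> powr s) \<partial>\<nu>) \<le> (\<integral>\<^sup>+x. 1 + (\<Sum>k. ennreal (a k) * indicator {2 ^ k<..} x) \<partial>\<nu>)"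
    using nonneg by (intro nn_integral_mono_AE, eventually_elim) (use dyadic in auto)
  also have "\<dots> = 1 + (\<Sum>k. ennreal (a k) * emeasure \<nu> {2 ^ k<..})"
    using emeasure_space_1
    by (subst nn_integral_add) (auto simp: nn_integral_suminf nn_integral_cmult)
  also have "\<dots> = 1 + (\<Sum>k. ennreal (a k * measure \<nu> {2 ^ k<..}))"
    by (simp add: emeasure_eq_measure ennreal_mult a_def)
  also have "\<dots> < \<infinity>"
    using fin by (simp add: less_top)
  finally show ?thesis
    by (intro integrableI_nonneg) auto
qed

text \<open>The Chernoff bound with exponent \<open>1\<close>, based on \<open>exp y \<le> 1 + 2 y\<close> for \<open>0 \<le> y \<le> 1\<close>. For \<open>t\<close> a
large multiple of the mean of the sum, it is exponentially small in that mean. Hoeffding's inequality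
sees only the number of summands and is void when the mean is of smaller order than its square root.\<close>

lemma (in prob_space) truncated_sum_upper_tail:
  fixes X :: "'i \<Rightarrow> 'a \<Rightarrow> real"
  assumes I: "finite I" and indep: "indep_vars (\<lambda>_. borel) X I"
    and range: "\<And>i \<omega>. i \<in> I \<Longrightarrow> X i \<omega> \<in> {0..1}"
    and mean: "\<And>i. i \<in> I \<Longrightarrow> expectation (X i) \<le> \<mu>"
  shows "prob {\<omega> \<in> space M. (\<Sum>i\<in>I. X i \<omega>) \<ge> t} \<le> exp (2 * real (card I) * \<mu> - t)"
proof -
  have rv[measurable]: "random_variable borel (X i)" if "i \<in> I" for i
    using indep that by (auto simp: indep_vars_def)
  have mgf: "(\<integral>\<^sup>+\<omega>. ennreal (exp (X i \<omega>)) \<partial>M) \<le> ennreal (exp (2 * \<mu>))" if i: "i \<in> I" for i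
  proof -
    have [measurable]: "random_variable borel (X i)" using rv i .
    have int: "integrable M (X i)"
      using range[OF i] by (intro integrable_const_bound[of _ 1]) auto
    have "(\<integral>\<^sup>+\<omega>. ennreal (exp (X i \<omega>)) \<partial>M) \<le> (\<integral>\<^sup>+\<omega>. ennreal (1 + 2 * X i \<omega>) \<partial>M)"
    proof (intro nn_integral_mono ennreal_leI)
      fix \<omega>
      have "exp (X i \<omega>) \<le> 1 + X i \<omega> + (X i \<omega>)\<^sup>2"
        using range[OF i, of \<omega>] by (intro exp_bound) auto
      also have "(X i \<omega>)\<^sup>2 \<le> X i \<omega>"
        using range[OF i, of \<omega>] by (simp add: power2_eq_square mult_left_le)
      finally show "exp (X i \<omega>) \<le> 1 + 2 * X i \<omega>" by simp
    qed
    also have "\<dots> = ennreal (expectation (\<lambda>\<omega>. 1 + 2 * X i \<omega>))"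
      using int range[OF i] by (intro nn_integral_eq_integral) auto
    also have "expectation (\<lambda>\<omega>. 1 + 2 * X i \<omega>) = 1 + 2 * expectation (X i)"
      using int by (simp add: prob_space)
    also have "\<dots> \<le> 1 + 2 * \<mu>"
      using mean[OF i] by simp
    also have "\<dots> \<le> exp (2 * \<mu>)"
      by (rule exp_ge_add_one_self)
    finally show ?thesis by (simp add: ennreal_leI)
  qed
  have "ennreal (prob {\<omega> \<in> space M. (\<Sum>i\<in>I. X i \<omega>) \<ge> t})
      = emeasure M {\<omega> \<in> space M. (\<Sum>i\<in>I. X i \<omega>) \<ge> t}"
    by (simp add: emeasure_eq_measure)
  also have "\<dots> \<le> ennreal (exp (-1 * t)) *
      (\<integral>\<^sup>+\<omega>. ennreal (exp (1 * (\<Sum>i\<in>I. X i \<omega>))) * indicator (space M) \<omega> \<partial>M)"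
    by (rule Chernoff_ineq_nn_integral_ge) auto
  also have "(\<integral>\<^sup>+\<omega>. ennreal (exp (1 * (\<Sum>i\<in>I. X i \<omega>))) * indicator (space M) \<omega> \<partial>M)
      = (\<integral>\<^sup>+\<omega>. (\<Prod>i\<in>I. ennreal (exp (X i \<omega>))) \<partial>M)"
    by (intro nn_integral_cong) (auto simp: exp_sum I prod_ennreal)
  also have "\<dots> = (\<Prod>i\<in>I. \<integral>\<^sup>+\<omega>. ennreal (exp (X i \<omega>)) \<partial>M)"
    by (intro indep_vars_nn_integral I indep_vars_compose2[OF indep]) auto
  also have "\<dots> \<le> (\<Prod>i\<in>I. ennreal (exp (2 * \<mu>)))"
    by (intro prod_mono_ennreal mgf)
  also have "\<dots> = ennreal (exp (2 * real (card I) * \<mu>))"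
    by (simp add: prod_ennreal exp_of_nat_mult[symmetric] mult_ac ennreal_power)
  also have "ennreal (exp (-1 * t)) * ennreal (exp (2 * real (card I) * \<mu>))
      = ennreal (exp (2 * real (card I) * \<mu> - t))"
    by (simp add: ennreal_mult[symmetric] exp_diff exp_minus field_simps)
  finally show ?thesis
    by (simp add: mult_left_mono)
qed

lemma (in prob_space) all_samples_le_probability:
  fixes X :: "'i \<Rightarrow> 'a \<Rightarrow> real"
  assumes I: "finite I" and indep: "indep_vars (\<lambda>_. borel) X I"
    and cdf: "\<And>i. i \<in> I \<Longrightarrow> prob {\<omega> \<in> space M. X i \<omega> \<le> m} \<le> 1 - p"
  shows "prob {\<omega> \<in> space M. \<forall>i\<in>I. X i \<omega> \<le> m} \<le> exp (- real (card I) * p)"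
proof (cases "I = {}")
  case True then show ?thesis by simp
next
  case False
  have "{\<omega> \<in> space M. \<forall>i\<in>I. X i \<omega> \<le> m} = (\<Inter>i\<in>I. X i -` {..m} \<inter> space M)"
    using False by auto
  then have "prob {\<omega> \<in> space M. \<forall>i\<in>I. X i \<omega> \<le> m} = (\<Prod>i\<in>I. prob (X i -` {..m} \<inter> space M))"
    using indep_varsD_finite[OF indep False I, of "\<lambda>_. {..m}"] by simp
  also have "\<dots> \<le> (\<Prod>i\<in>I. exp (- p))"
  proof (intro prod_mono conjI)
    fix i assume "i \<in> I"
    have "X i -` {..m} \<inter> space M = {\<omega> \<in> space M. X i \<omega> \<le> m}" by auto
    with cdf[OF \<open>i \<in> I\<close>] have "prob (X i -` {..m} \<inter> space M) \<le> 1 + - p" by simp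
    also have "\<dots> \<le> exp (- p)" by (rule exp_ge_add_one_self)
    finally show "prob (X i -` {..m} \<inter> space M) \<le> exp (- p)" .
  qed auto
  also have "\<dots> = exp (- real (card I) * p)"
    by (simp add: exp_of_nat_mult[symmetric])
  finally show ?thesis .
qed

section \<open>Graphs with random degrees\<close>

lemma measurable_parity_corrected_degree:
  assumes \<xi>: "\<And>j. j \<in> {1..n} \<Longrightarrow> \<xi> j \<in> borel_measurable M" and i: "i \<in> {1..n}"
  shows "(\<lambda>\<omega>. parity_corrected_degree n (\<lambda>j. \<xi> j \<omega>) i) \<in> borel_measurable M"
proof -
  have [measurable]: "\<xi> i \<in> borel_measurable M" "(\<lambda>\<omega>. \<Sum>j=1..n. \<xi> j \<omega>) \<in> borel_measurable M"
    using \<xi> i by auto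
  show ?thesis
    unfolding parity_corrected_degree_def by measurable
qed

text \<open>The quantifier ranges over the finitely many graphs on \<open>{1..n}\<close>. Measurability is essential: a set
that is not measurable would have measure \<open>0\<close>.\<close>

lemma sets_all_realizations:
  assumes \<xi>: "\<And>j. j \<in> {1..n} \<Longrightarrow> \<xi> j \<in> borel_measurable M"
  shows "{\<omega> \<in> space M. \<forall>E. simple_graph {1..n} E \<and>
            (\<forall>i\<in>{1..n}. real (vertex_degree E i) = parity_corrected_degree n (\<lambda>j. \<xi> j \<omega>) i) \<longrightarrow> Q E}
         \<in> sets M"
proof -
  have "{E. simple_graph {1..n} E} \<subseteq> Pow (Pow {1..n})"
    by (auto simp: simple_graph_def)
  then have fin: "finite {E. simple_graph {1..n} E}"
    by (rule finite_subset) simp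
  have "{\<omega> \<in> space M. \<forall>E\<in>{E. simple_graph {1..n} E}.
            (\<forall>i\<in>{1..n}. real (vertex_degree E i) = parity_corrected_degree n (\<lambda>j. \<xi> j \<omega>) i) \<longrightarrow> Q E}
         \<in> sets M"
  proof (intro sets.sets_Collect_finite_All sets.sets_Collect_imp sets.sets_Collect_const fin)
    fix E i assume "i \<in> {1..n}"
    note [measurable] = measurable_parity_corrected_degree[OF \<xi> this]
    show "{\<omega> \<in> space M. real (vertex_degree E i) = parity_corrected_degree n (\<lambda>j. \<xi> j \<omega>) i} \<in> sets M"
      by measurable
  qed auto
  moreover have "{\<omega> \<in> space M. \<forall>E. simple_graph {1..n} E \<and>
            (\<forall>i\<in>{1..n}. real (vertex_degree E i) = parity_corrected_degree n (\<lambda>j. \<xi> j \<omega>) i) \<longrightarrow> Q E}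
     = {\<omega> \<in> space M. \<forall>E\<in>{E. simple_graph {1..n} E}.
            (\<forall>i\<in>{1..n}. real (vertex_degree E i) = parity_corrected_degree n (\<lambda>j. \<xi> j \<omega>) i) \<longrightarrow> Q E}"
    by auto
  ultimately show ?thesis by simp
qed

text \<open>The deterministic core: the parity correction raises one degree only, so it changes the truncated
sum by at most \<open>1\<close> and does not lower the largest degree.\<close>

lemma global_clustering_le_of_samples:
  fixes k m :: real
  assumes G: "simple_graph {1..n} E"
    and deg: "\<And>i. i \<in> {1..n} \<Longrightarrow> real (vertex_degree E i) = parity_corrected_degree n x i"
    and W: "(\<Sum>i=1..n. min ((x i)\<^sup>2 / real n) 1) \<le> k"
    and i: "i \<in> {1..n}" "m \<le> x i" and m: "m \<ge> 2"
  shows "global_clustering E \<le> 12 * ((k + 1) ^ 3 + real n * (k + 1)) / m\<^sup>2"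
proof (rule global_clustering_le[OF G _ m])
  have n: "n \<ge> 1" using i by simp
  then show "0 < real n" by simp
  show "m \<le> real (vertex_degree E i)"
    using i deg[OF i(1)] by (auto simp: parity_corrected_degree_def)
  have n_split: "{1..n} = insert n {1..<n}"
    using n by auto
  have "(\<Sum>j\<in>{1..<n}. min ((real (vertex_degree E j))\<^sup>2 / real n) 1)
      = (\<Sum>j\<in>{1..<n}. min ((x j)\<^sup>2 / real n) 1)"
    by (intro sum.cong) (auto simp: deg parity_corrected_degree_def)
  also have "\<dots> \<le> (\<Sum>j=1..n. min ((x j)\<^sup>2 / real n) 1)"
    using n by (intro sum_mono2) auto
  finally have "(\<Sum>j\<in>{1..<n}. min ((real (vertex_degree E j))\<^sup>2 / real n) 1) \<le> k"
    using W by linarith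
  then show "(\<Sum>j=1..n. min ((real (vertex_degree E j))\<^sup>2 / real n) 1) \<le> k + 1"
    unfolding n_split by simp
qed

text \<open>This turns a moment of order \<open>s\<close> into a bound for the mean of a truncated square; it is the inequality
\<open>min y 1 \<le> y powr (s / 2)\<close> for \<open>y \<ge> 0\<close>.\<close>

lemma truncated_square_le_powr:
  fixes x \<tau> s :: real
  assumes \<tau>: "\<tau> > 0" and s: "0 < s" "s \<le> 2"
  shows "min (x\<^sup>2 / \<tau>) 1 \<le> \<tau> powr (- s / 2) * \<bar>x\<bar> powr s"
proof -
  define y where "y = x\<^sup>2 / \<tau>"
  have y0: "y \<ge> 0" using \<tau> by (simp add: y_def)
  have "min y 1 \<le> y powr (s / 2)"
  proof (cases "y \<le> 1")
    case True
    then have "y powr 1 \<le> y powr (s / 2)"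
      using y0 s by (intro powr_mono') auto
    then show ?thesis using True y0 by simp
  next
    case False
    then have "1 \<le> y powr (s / 2)" using s by (intro ge_one_powr_ge_zero) auto
    then show ?thesis by simp
  qed
  also have "\<dots> = \<tau> powr (- s / 2) * \<bar>x\<bar> powr s"
  proof (cases "x = 0")
    case False
    then have "(x\<^sup>2) powr (s / 2) = (\<bar>x\<bar> powr 2) powr (s / 2)"
      by simp
    also have "\<dots> = \<bar>x\<bar> powr s"
      by (simp only: powr_powr) simp
    finally have "y powr (s / 2) = \<bar>x\<bar> powr s / \<tau> powr (s / 2)"
      using \<tau> by (simp add: y_def powr_divide)
    then show ?thesis
      using powr_minus_divide[of \<tau> "s / 2"] by simp
  qed (simp add: y_def)
  finally show ?thesis by (simp add: y_def)
qed

text \<open>The clustering bound can fail only if the truncated sum reaches \<open>k\<close> or no sample exceeds \<open>m\<close>. The first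
event is handled by the Chernoff bound, the second by independence.\<close>

lemma (in prob_space) clustering_failure_probability:
  fixes \<xi> :: "nat \<Rightarrow> 'a \<Rightarrow> real" and \<nu> :: "real measure" and s k m B :: real
  assumes n: "n \<ge> 1" and indep: "indep_vars (\<lambda>_. borel) \<xi> {1..n}"
    and \<nu>: "real_distribution \<nu>" and distr: "\<And>i. i \<in> {1..n} \<Longrightarrow> distr M borel (\<xi> i) = \<nu>"
    and s: "0 < s" "s \<le> 2" and moment: "integrable \<nu> (\<lambda>x. \<bar>x\<bar> powr s)"
    and m: "m \<ge> 2" and B: "12 * ((k + 1) ^ 3 + real n * (k + 1)) / m\<^sup>2 \<le> B"
  shows "1 - prob {\<omega> \<in> space M. \<forall>E. simple_graph {1..n} E \<and>
             (\<forall>i\<in>{1..n}. real (vertex_degree E i) = parity_corrected_degree n (\<lambda>j. \<xi> j \<omega>) i) \<longrightarrow>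
             global_clustering E \<le> B}
         \<le> exp (2 * real n powr (1 - s / 2) * (\<integral>x. \<bar>x\<bar> powr s \<partial>\<nu>) - k)
           + exp (- real n * measure \<nu> {m<..})"
proof -
  interpret \<nu>: real_distribution \<nu> by fact
  define K where "K = (\<integral>x. \<bar>x\<bar> powr s \<partial>\<nu>)"
  define G where "G = {\<omega> \<in> space M. \<forall>E. simple_graph {1..n} E \<and>
             (\<forall>i\<in>{1..n}. real (vertex_degree E i) = parity_corrected_degree n (\<lambda>j. \<xi> j \<omega>) i) \<longrightarrow>
             global_clustering E \<le> B}"
  define Y where "Y i \<omega> = min ((\<xi> i \<omega>)\<^sup>2 / real n) 1" for i \<omega>
  define heavy where "heavy = {\<omega> \<in> space M. k \<le> (\<Sum>i=1..n. Y i \<omega>)}"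
  define light where "light = {\<omega> \<in> space M. \<forall>i\<in>{1..n}. \<xi> i \<omega> \<le> m}"
  have rv: "random_variable borel (\<xi> i)" if "i \<in> {1..n}" for i
    using indep that by (auto simp: indep_vars_def)
  have Y: "indep_vars (\<lambda>_. borel) Y {1..n}"
    unfolding Y_def[abs_def] by (intro indep_vars_compose2[OF indep]) auto
  have Y_rv: "random_variable borel (Y i)" if "i \<in> {1..n}" for i
    using Y that by (auto simp: indep_vars_def)
  have G_sets: "G \<in> events"
    unfolding G_def by (rule sets_all_realizations[OF rv])
  have heavy_sets: "heavy \<in> events"
    unfolding heavy_def using Y_rv by (intro borel_measurable_le borel_measurable_sum) auto
  have light_sets: "light \<in> events"
    unfolding light_def using rv by (intro sets.sets_Collect_finite_All borel_measurable_le) auto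
  have sub: "space M - G \<subseteq> heavy \<union> light"
  proof
    fix \<omega> assume \<omega>: "\<omega> \<in> space M - G"
    show "\<omega> \<in> heavy \<union> light"
    proof (rule ccontr)
      assume "\<omega> \<notin> heavy \<union> light"
      then obtain i where i: "i \<in> {1..n}" "m \<le> \<xi> i \<omega>" and W: "(\<Sum>i=1..n. Y i \<omega>) \<le> k"
        using \<omega> by (force simp: heavy_def light_def)
      have "\<omega> \<in> G"
        unfolding G_def using \<omega> W i m
        by (auto simp: Y_def intro!: order_trans[OF global_clustering_le_of_samples B])
      with \<omega> show False by simp
    qed
  qed
  have mean: "expectation (Y i) \<le> real n powr (- s / 2) * K" if i: "i \<in> {1..n}" for i
  proof -
    have "expectation (Y i) = (\<integral>x. min (x\<^sup>2 / real n) 1 \<partial>distr M borel (\<xi> i))"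
      unfolding Y_def using rv[OF i] by (subst integral_distr) auto
    also have "\<dots> = (\<integral>x. min (x\<^sup>2 / real n) 1 \<partial>\<nu>)"
      by (simp add: distr[OF i])
    also have "\<dots> \<le> (\<integral>x. real n powr (- s / 2) * \<bar>x\<bar> powr s \<partial>\<nu>)"
    proof (rule integral_mono)
      show "integrable \<nu> (\<lambda>x. min (x\<^sup>2 / real n) 1)"
        by (intro \<nu>.integrable_const_bound[of _ 1]) auto
      show "integrable \<nu> (\<lambda>x. real n powr (- s / 2) * \<bar>x\<bar> powr s)"
        using moment by simp
      show "min (x\<^sup>2 / real n) 1 \<le> real n powr (- s / 2) * \<bar>x\<bar> powr s" for x
        using n s by (intro truncated_square_le_powr) auto
    qed
    also have "\<dots> = real n powr (- s / 2) * K"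
      by (simp add: K_def)
    finally show ?thesis .
  qed
  have "prob heavy \<le> exp (2 * real (card {1..n}) * (real n powr (- s / 2) * K) - k)"
    unfolding heavy_def by (intro truncated_sum_upper_tail Y mean) (auto simp: Y_def)
  also have "2 * real (card {1..n}) * (real n powr (- s / 2) * K) = 2 * real n powr (1 - s / 2) * K"
  proof -
    have "real n * real n powr (- s / 2) = real n powr (1 - s / 2)"
      using n powr_add[of "real n" 1 "- s / 2"] by simp
    then show ?thesis by simp
  qed
  finally have heavy: "prob heavy \<le> exp (2 * real n powr (1 - s / 2) * K - k)" .
  have "prob light \<le> exp (- real (card {1..n}) * measure \<nu> {m<..})"
    unfolding light_def
  proof (intro all_samples_le_probability indep)
    fix i assume i: "i \<in> {1..n}"
    have "prob {\<omega> \<in> space M. \<xi> i \<omega> \<le> m} = measure (distr M borel (\<xi> i)) {..m}"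
      using rv[OF i] by (subst measure_distr) (auto intro!: arg_cong[of _ _ prob])
    also have "\<dots> = 1 - measure \<nu> {m<..}"
      using \<nu>.prob_compl[of "{m<..}"] by (simp add: distr[OF i] Compl_eq_Diff_UNIV[symmetric])
    finally show "prob {\<omega> \<in> space M. \<xi> i \<omega> \<le> m} \<le> 1 - measure \<nu> {m<..}" by simp
  qed simp
  then have light: "prob light \<le> exp (- real n * measure \<nu> {m<..})" by simp
  have "1 - prob G = prob (space M - G)"
    by (simp add: prob_compl G_sets)
  also have "\<dots> \<le> prob (heavy \<union> light)"
    using sub heavy_sets light_sets by (intro finite_measure_mono) auto
  also have "\<dots> \<le> prob heavy + prob light"
    by (rule measure_Un_le[OF heavy_sets light_sets])
  finally show ?thesis
    using heavy light unfolding G_def K_def by linarith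
qed

section \<open>The clustering coefficient of scale-free graphs\<close>

lemma exp_neg_powr_bigo:
  fixes a c r :: real
  assumes "a > 0" "c > 0"
  shows "(\<lambda>n::nat. exp (- c * real n powr a)) \<in> O(\<lambda>n. real n powr r)"
  using assms by real_asymp

theorem theorem4:
  fixes \<gamma> \<epsilon> \<alpha> :: real and L F :: "real \<Rightarrow> real" and \<nu> :: "real measure"
    and M :: "nat \<Rightarrow> 'a measure" and \<xi> :: "nat \<Rightarrow> nat \<Rightarrow> 'a \<Rightarrow> real"
  assumes "1 < \<gamma>" and "\<gamma> < 2"
    and "real_distribution \<nu>"
    and "AE x in \<nu>. \<exists>k::nat. k \<ge> 1 \<and> x = real k"
    and "F = cdf \<nu>"
    and "slowly_varying L"
    and "\<And>x. x > 0 \<Longrightarrow> 1 - F x = L x * x powr (- \<gamma>)"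
    and "\<And>n. prob_space (M n)"
    and "\<And>n. prob_space.indep_vars (M n) (\<lambda>_. borel) (\<xi> n) {1..n}"
    and "\<And>n i. i \<in> {1..n} \<Longrightarrow> cdf (distr (M n) borel (\<xi> n i)) = F"
    and "\<epsilon> > 0"
    and "1 < \<alpha>" and "\<alpha> < min (2 - \<gamma> / 2) \<gamma>"
  shows "(\<lambda>n. 1 - measure (M n) {\<omega> \<in> space (M n).
             \<forall>E. simple_graph {1..n} E \<and>
                 (\<forall>i\<in>{1..n}. real (vertex_degree E i) =
                    parity_corrected_degree n (\<lambda>j. \<xi> n j \<omega>) i) \<longrightarrow>
                 global_clustering E \<le> real n powr (\<epsilon> - (\<gamma> - 2)\<^sup>2 / (2 * \<gamma>))})
         \<in> O(\<lambda>n. real n powr (1 - \<alpha>))"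
    (is "(\<lambda>n. 1 - measure (M n) (?good n)) \<in> _")
proof -
  interpret \<nu>: real_distribution \<nu> by fact
  have \<gamma>: "1 < \<gamma>" "\<gamma> < 2" and \<epsilon>: "\<epsilon> > 0" by fact+
  \<comment> \<open>\<open>\<delta>\<close> is the loss allowed in each exponent. The bound by \<open>(\<gamma> - 1) / 2\<close> gives \<open>a \<le> 1 / 2\<close>, which makes
  the cubic term below no larger than the linear one; three losses must fit into \<open>\<epsilon>\<close>.\<close>
  define \<delta> where "\<delta> = min ((\<gamma> - 1) / 2) (\<epsilon> / 4)"
  have \<delta>: "\<delta> > 0" "\<delta> \<le> (\<gamma> - 1) / 2" "\<delta> \<le> \<epsilon> / 4"
    using \<gamma> \<epsilon> unfolding \<delta>_def by (auto simp: min_def)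
  define s where "s = \<gamma> - 2 * \<delta>"
  \<comment> \<open>Up to constants, \<open>n powr a\<close> is the truncated sum, \<open>n powr \<theta>\<close> is exceeded by the largest sample,
  and \<open>n powr b\<close> bounds from below the expected number of samples that do so.\<close>
  define a where "a = 1 - s / 2"
  define \<theta> where "\<theta> = 1 / \<gamma> - \<delta>"
  define b where "b = 1 - \<theta> * (\<gamma> + \<delta>)"
  have s: "0 < s" "s \<le> 2" and a: "0 < a" "a \<le> 1 / 2"
    using \<gamma> \<delta> by (auto simp: s_def a_def)
  have \<theta>: "\<theta> > 0"
  proof -
    have "\<delta> * \<gamma> \<le> (\<gamma> - 1) / 2 * \<gamma>"
      using \<delta> \<gamma> by (intro mult_right_mono) auto
    also have "\<dots> < 1 / 2 * 2"
      using \<gamma> by (intro mult_strict_mono) auto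
    finally show ?thesis using \<gamma> by (simp add: \<theta>_def field_simps)
  qed
  have b: "b > 0"
  proof -
    have "b = \<delta> * (\<gamma> - 1 / \<gamma> + \<delta>)"
      using \<gamma> by (simp add: b_def \<theta>_def field_simps)
    moreover have "1 / \<gamma> < \<gamma>" using \<gamma> by (simp add: field_simps less_1_mult)
    ultimately show ?thesis using \<delta> by simp
  qed

  have tail: "measure \<nu> {x<..} = L x * x powr (- \<gamma>)" if "x > 0" for x
  proof -
    have "measure \<nu> {x<..} = 1 - cdf \<nu> x"
      using \<nu>.prob_compl[of "{..x}"] by (simp add: cdf_def Compl_eq_Diff_UNIV[symmetric])
    then show ?thesis using assms(5) assms(7)[OF that] by simp
  qed
  obtain C where C: "C > 0" and C_upper: "\<forall>\<^sub>F x in at_top. L x \<le> C * x powr \<delta>"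
    and C_lower: "\<forall>\<^sub>F x in at_top. x powr (- \<delta>) / C \<le> L x"
  proof (rule slowly_varying_power_bounds[OF assms(6)])
    show "L y * y powr (- \<gamma>) \<le> L x * x powr (- \<gamma>)" if "0 < x" "x \<le> y" for x y
      using that tail[of x] tail[of y] \<nu>.finite_measure_mono[of "{y<..}" "{x<..}"] by simp
  qed (use \<gamma> \<delta> in auto)

  have moment: "integrable \<nu> (\<lambda>x. \<bar>x\<bar> powr s)"
  proof (rule moment_finite_if_tail_le_powr[OF assms(3)])
    show "AE x in \<nu>. 0 \<le> x"
      using assms(4) by eventually_elim auto
    show "s < \<gamma> - \<delta>" using \<delta> by (simp add: s_def)
    show "\<forall>\<^sub>F x in at_top. measure \<nu> {x<..} \<le> C * x powr (- (\<gamma> - \<delta>))"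
      using C_upper eventually_gt_at_top[of 0]
    proof eventually_elim
      case (elim x)
      have "measure \<nu> {x<..} \<le> C * x powr \<delta> * x powr (- \<gamma>)"
        unfolding tail[OF elim(2)] by (rule mult_right_mono[OF elim(1)]) simp
      then show ?case using elim(2) by (simp add: mult.assoc powr_add[symmetric])
    qed
  qed (use s in auto)
  define K where "K = (\<integral>x. \<bar>x\<bar> powr s \<partial>\<nu>)"
  have K: "K \<ge> 0" by (simp add: K_def)
  define c where "c = 2 * K + 2"
  \<comment> \<open>The mean of the truncated sum is at most \<open>K * n powr a\<close>. The Chernoff bound loses a factor \<open>2\<close>, and the
  additional \<open>1\<close> leaves an error of \<open>exp (- (n powr a))\<close>.\<close>
  define k where "k n = (2 * K + 1) * real n powr a" for n
  define m where "m n = real n powr \<theta>" for n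
  have m_lim: "filterlim m at_top sequentially"
    unfolding m_def[abs_def] using \<theta> by real_asymp

  have clustering: "\<forall>\<^sub>F n in sequentially.
      12 * ((k n + 1) ^ 3 + real n * (k n + 1)) / (m n)\<^sup>2 \<le> real n powr (\<epsilon> - (\<gamma> - 2)\<^sup>2 / (2 * \<gamma>))"
  proof -
    \<comment> \<open>The clustering coefficient turns out to be of order \<open>n powr (3 * \<delta> - (\<gamma> - 2)^2 / (2 * \<gamma>))\<close>; the rest
    of \<open>\<epsilon>\<close> absorbs the constant.\<close>
    have "filterlim (\<lambda>n. real n powr (\<epsilon> - 3 * \<delta>)) at_top sequentially"
      using \<delta> \<epsilon> by real_asymp
    then have "\<forall>\<^sub>F n in sequentially. 12 * (c ^ 3 + c) \<le> real n powr (\<epsilon> - 3 * \<delta>)"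
      by (simp add: filterlim_at_top)
    with eventually_ge_at_top[of 1] show ?thesis
    proof eventually_elim
      case (elim n)
      let ?N = "real n"
      have N: "?N \<ge> 1" using elim(1) by simp
      have k: "k n + 1 \<le> c * ?N powr a" "0 \<le> k n + 1"
        using ge_one_powr_ge_zero[OF N, of a] a K by (auto simp: k_def c_def algebra_simps)
      have "(k n + 1) ^ 3 \<le> (c * ?N powr a) ^ 3"
        using k by (rule power_mono)
      also have "\<dots> = c ^ 3 * ?N powr (3 * a)"
        using N by (simp add: power_mult_distrib powr_power mult.commute)
      also have "\<dots> \<le> c ^ 3 * ?N powr (1 + a)"
        using N a K by (intro mult_left_mono powr_mono) (auto simp: c_def)
      finally have cube: "(k n + 1) ^ 3 \<le> c ^ 3 * ?N powr (1 + a)" .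
      have "?N * (k n + 1) \<le> ?N * (c * ?N powr a)"
        using k N by (intro mult_left_mono) auto
      also have "\<dots> = c * ?N powr (1 + a)"
        using N by (simp add: powr_add)
      finally have lin: "?N * (k n + 1) \<le> c * ?N powr (1 + a)" .
      have m2: "(m n)\<^sup>2 = ?N powr (2 * \<theta>)"
        using N by (simp add: m_def powr_power mult.commute)
      have "12 * ((k n + 1) ^ 3 + ?N * (k n + 1)) / (m n)\<^sup>2
          \<le> 12 * ((c ^ 3 + c) * ?N powr (1 + a)) / (m n)\<^sup>2"
        using cube lin by (intro divide_right_mono) (auto simp: algebra_simps)
      also have "\<dots> = 12 * (c ^ 3 + c) * ?N powr (1 + a - 2 * \<theta>)"
        using N by (simp add: m2 powr_diff)
      also have "1 + a - 2 * \<theta> = 3 * \<delta> - (\<gamma> - 2)\<^sup>2 / (2 * \<gamma>)"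
        using \<gamma> by (simp add: a_def s_def \<theta>_def field_simps power2_eq_square)
      also have "12 * (c ^ 3 + c) * ?N powr (3 * \<delta> - (\<gamma> - 2)\<^sup>2 / (2 * \<gamma>))
          \<le> ?N powr (\<epsilon> - 3 * \<delta>) * ?N powr (3 * \<delta> - (\<gamma> - 2)\<^sup>2 / (2 * \<gamma>))"
        by (intro mult_right_mono elim) simp
      also have "\<dots> = ?N powr (\<epsilon> - (\<gamma> - 2)\<^sup>2 / (2 * \<gamma>))"
        using N by (simp add: powr_add[symmetric])
      finally show ?case .
    qed
  qed

  have failure: "\<forall>\<^sub>F n in sequentially.
      norm (1 - measure (M n) (?good n))
        \<le> 1 * norm (exp (- 1 * real n powr a) + exp (- (1 / C) * real n powr b))"
    using clustering eventually_ge_at_top[of 1] m_lim[unfolded filterlim_at_top, rule_format, of 2]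
      eventually_compose_filterlim[OF C_lower m_lim]
  proof eventually_elim
    case (elim n)
    interpret prob_space "M n" by fact
    have N: "real n \<ge> 1" using elim(2) by simp
    have distr: "distr (M n) borel (\<xi> n i) = \<nu>" if i: "i \<in> {1..n}" for i
    proof (rule cdf_unique)
      have "random_variable borel (\<xi> n i)"
        using assms(9)[of n] i by (auto simp: indep_vars_def)
      then show "real_distribution (distr (M n) borel (\<xi> n i))"
        by (rule real_distribution_distr)
    qed (use assms i in auto)
    have "1 - measure (M n) (?good n)
        \<le> exp (2 * real n powr (1 - s / 2) * K - k n) + exp (- real n * measure \<nu> {m n<..})"
      unfolding K_def
      by (rule clustering_failure_probability[OF elim(2) assms(9) assms(3) distr s moment elim(3,1)])
    also have "2 * real n powr (1 - s / 2) * K - k n = - 1 * real n powr a"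
      by (simp add: k_def a_def algebra_simps)
    also have "exp (- real n * measure \<nu> {m n<..}) \<le> exp (- (1 / C) * real n powr b)"
    proof -
      have m_pos: "m n > 0" using elim(3) by simp
      have "real n powr b / C = real n * (m n powr (- \<delta>) / C * m n powr (- \<gamma>))"
      proof -
        have "m n powr (- \<delta>) * m n powr (- \<gamma>) = real n powr (- (\<theta> * (\<gamma> + \<delta>)))"
          by (simp add: m_def powr_powr powr_add[symmetric] algebra_simps)
        moreover have "real n powr b = real n * real n powr (- (\<theta> * (\<gamma> + \<delta>)))"
          using N powr_add[of "real n" 1 "- (\<theta> * (\<gamma> + \<delta>))"] by (simp add: b_def)
        ultimately show ?thesis by simp
      qed
      also have "\<dots> \<le> real n * measure \<nu> {m n<..}"
        unfolding tail[OF m_pos] using elim(4) by (intro mult_left_mono mult_right_mono) auto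
      finally show ?thesis by simp
    qed
    finally show ?case by simp
  qed
  have "(\<lambda>n. 1 - measure (M n) (?good n))
      \<in> O(\<lambda>n. exp (- 1 * real n powr a) + exp (- (1 / C) * real n powr b))"
    using failure by (rule bigoI)
  also have "(\<lambda>n. exp (- 1 * real n powr a) + exp (- (1 / C) * real n powr b))
      \<in> O(\<lambda>n. real n powr (1 - \<alpha>))"
    using a b C by (intro sum_in_bigo exp_neg_powr_bigo) auto
  finally show ?thesis .
qed

end
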